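(* Let $k\geq 3$ and $n\ge 1$. If a Grassmanian permutation $\pi\in\mathcal{S}_n$ satisfies $\pi(1)\neq 1$, $\pi(n)\neq n$ and $\operatorname{des}(\pi^k)=1$, then either (i) there exists $s\in[n]$ such that $\pi(i)\equiv i+s\pmod n$ for all $i\in[n]$, or (ii) $\pi^{k-1}=\mathrm{id}$.
   Context: $\mathcal{S}_n$ is the symmetric group on $[n]=\{1,\dots,n\}$. For $\pi\in\mathcal{S}_n$, $\operatorname{des}(\pi)$ is the number of indices $i\in[n-1]$ with $\pi(i)>\pi(i+1)$. A permutation $\pi$ is Grassmanian if $\operatorname{des}(\pi)\le 1$. $\mathrm{id}$ denotes the identity permutation. *)

theory Defs
  imports "HOL-Combinatorics.Permutations" "HOL-Number_Theory.Cong"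
begin

text \<open>
  Permutations of $[n]$ are functions on the naturals that satisfy \<open>\<pi> permutes {1..n}\<close>;
  they fix every number outside \<open>{1..n}\<close>, so that the identity of the symmetric group is
  \<^const>\<open>id\<close>, its product is composition, and its powers are given by \<open>^^\<close>.
\<close>

definition des :: "nat \<Rightarrow> (nat \<Rightarrow> nat) \<Rightarrow> nat" where
  "des n \<pi> = card {i \<in> {1..<n}. \<pi> i > \<pi> (i + 1)}"

definition grassmannian :: "nat \<Rightarrow> (nat \<Rightarrow> nat) \<Rightarrow> bool" where
  "grassmannian n \<pi> \<longleftrightarrow> \<pi> permutes {1..n} \<and> des n \<pi> \<le> 1"

end

theory Submission
  imports Defs "HOL-Combinatorics.Cycles"
begin

text \<open>
  A non-rotation \<open>\<pi>\<close> with unique descent \<open>d\<close> satisfies \<open>\<pi> 1 < \<pi> n\<close>, \<open>\<pi> d = n\<close>, \<open>\<pi> (d + 1) = 1\<close>, moves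
  \<open>{1..d}\<close> up and \<open>{d<..n}\<close> down.  If a power \<open>\<rho>\<close> of \<open>\<pi>\<close> has a unique descent \<open>e\<close>, then \<open>\<rho>\<close> is of the
  same kind, so \<open>\<pi> \<circ> \<rho> = \<rho> \<circ> \<pi>\<close> sends \<open>e, e + 1\<close> to \<open>\<pi> n, \<pi> 1\<close> and descends at \<open>e\<close>.  For \<open>e \<noteq> d\<close> this
  would make \<open>\<pi>\<close> map \<open>e, e + 1\<close> to opposite sides of \<open>e\<close>, which is impossible; hence \<open>e = d\<close>.
  Next, either \<open>\<pi> i\<close> and \<open>\<rho> i\<close> always lie on the same side of \<open>d\<close>, or \<open>\<pi> \<circ> \<rho>\<close> again has \<open>d\<close> as its
  only descent.  With \<open>\<rho> = \<pi>^k\<close>, in the first case \<open>i\<close> and \<open>\<pi>^(k-1) i\<close> have the same itinerary with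
  respect to \<open>d\<close>, so all powers of \<open>\<pi>\<close> preserve their order, and finiteness forces \<open>\<pi>^(k-1) = id\<close>.
  If that fails, the second case propagates to all higher powers, none of which can then
  be the identity, contradicting the finite order of \<open>\<pi>\<close>.
\<close>

section \<open>Unique descents and growth along the two runs\<close>

definition only_descent :: "nat \<Rightarrow> (nat \<Rightarrow> nat) \<Rightarrow> nat \<Rightarrow> bool" where
  "only_descent n \<rho> d \<longleftrightarrow> {i \<in> {1..<n}. \<rho> i > \<rho> (i + 1)} = {d}"

lemma des_eq_1_iff: "des n \<rho> = 1 \<longleftrightarrow> (\<exists>d. only_descent n \<rho> d)"
  unfolding des_def only_descent_def by (simp add: card_1_singleton_iff)

lemma only_descentD:
  assumes "only_descent n \<rho> d"
  shows "1 \<le> d" "d < n" "\<rho> (Suc d) < \<rho> d"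
  using assms unfolding only_descent_def by auto

lemma only_descent_uniq:
  assumes "only_descent n \<rho> d" "1 \<le> i" "i < n" "\<rho> (Suc i) < \<rho> i"
  shows "i = d"
  using assms unfolding only_descent_def by auto

lemma only_descent_imp_ne_id: "only_descent n \<rho> d \<Longrightarrow> \<rho> \<noteq> id"
  by (auto dest: only_descentD(3))

lemma gap_le_of_step_less:
  fixes f :: "nat \<Rightarrow> nat"
  assumes "i \<le> j" and "\<And>l. i \<le> l \<Longrightarrow> l < j \<Longrightarrow> f l < f (Suc l)"
  shows "f i + (j - i) \<le> f j"
  using assms
proof (induction j rule: dec_induct)
  case (step m)
  have "f i + (m - i) \<le> f m" by (rule step.IH) (use step.prems in auto)
  with step.prems[of m] step.hyps show ?case by auto
qed simp

lemma only_descent_step: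
  assumes "\<rho> permutes {1..n}" "only_descent n \<rho> d" "1 \<le> i" "i < n" "i \<noteq> d"
  shows "\<rho> i < \<rho> (Suc i)"
proof -
  have "\<rho> i \<noteq> \<rho> (Suc i)"
    using permutes_inj[OF assms(1)] by (metis injD n_not_Suc_n)
  with only_descent_uniq[OF assms(2-4)] assms(5) show ?thesis by fastforce
qed

lemma only_descent_gap:
  assumes "\<rho> permutes {1..n}" "only_descent n \<rho> d" "1 \<le> i" "i \<le> j" "j \<le> n" "j \<le> d \<or> d < i"
  shows "\<rho> i + (j - i) \<le> \<rho> j"
  by (rule gap_le_of_step_less) (use assms in \<open>auto intro!: only_descent_step[OF assms(1,2)]\<close>)

lemma only_descent_less_iff:
  assumes "\<rho> permutes {1..n}" "only_descent n \<rho> d" "i \<in> {1..n}" "j \<in> {1..n}" "i \<le> d \<longleftrightarrow> j \<le> d"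
  shows "\<rho> i < \<rho> j \<longleftrightarrow> i < j"
proof -
  have less: "\<rho> a < \<rho> b" if "a < b" "a \<in> {1..n}" "b \<in> {1..n}" "a \<le> d \<longleftrightarrow> b \<le> d" for a b
    using only_descent_gap[OF assms(1,2), of a b] that by auto
  show ?thesis
    using less[of i j] less[of j i] assms by (cases i j rule: linorder_cases) auto
qed

section \<open>Permutations with one descent that move both endpoints\<close>

locale descent_perm =
  fixes n d :: nat and \<pi> :: "nat \<Rightarrow> nat"
  assumes perm: "\<pi> permutes {1..n}"
    and desc: "only_descent n \<pi> d"
    and first: "\<pi> 1 \<noteq> 1"
    and last: "\<pi> n \<noteq> n"
begin

lemma d_bounds: "1 \<le> d" "d < n"
  using only_descentD[OF desc] by auto

lemma in_range [simp]: "\<pi> i \<in> {1..n} \<longleftrightarrow> i \<in> {1..n}"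
  using permutes_in_image[OF perm] .

lemma bounds: "1 \<le> i \<Longrightarrow> i \<le> n \<Longrightarrow> 1 \<le> \<pi> i \<and> \<pi> i \<le> n"
  using in_range[of i] by (metis atLeastAtMost_iff)

text \<open>Gaps do not shrink within a run, so the displacement of 1, which is positive by
  \<open>first\<close>, carries over to all of \<open>{1..d}\<close>. The lemma \<open>down\<close>
  mirrors this from \<open>n\<close>.\<close>

lemma up: "1 \<le> i \<Longrightarrow> i \<le> d \<Longrightarrow> i < \<pi> i"
  using only_descent_gap[OF perm desc, of 1 i] first bounds[of 1] d_bounds by auto

lemma down: "d < i \<Longrightarrow> i \<le> n \<Longrightarrow> \<pi> i < i"
  using only_descent_gap[OF perm desc, of i n] last bounds[of n] d_bounds by auto

lemma top: "\<pi> d = n"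
proof -
  obtain j where j: "\<pi> j = n" using permutes_surj[OF perm] by (metis surjD)
  then have *: "1 \<le> j" "j < n" using in_range[of j] d_bounds last by (auto simp: le_less)
  then have "j = d"
    using only_descent_step[OF perm desc, of j] bounds[of "Suc j"] j by fastforce
  with j show ?thesis by simp
qed

lemma bottom: "\<pi> (Suc d) = 1"
proof -
  obtain j where j: "\<pi> j = 1" using permutes_surj[OF perm] by (metis surjD)
  then have *: "1 < j" "j \<le> n" using in_range[of j] d_bounds first by (auto intro!: le_neq_implies_less)
  then have "j - 1 = d"
    using only_descent_step[OF perm desc, of "j - 1"] bounds[of "j - 1"] j by fastforce
  with j * show ?thesis by auto
qed

text \<open>The points moved by \<open>\<rho>\<close> form an interval that is invariant under \<open>\<pi>\<close>.  Since \<open>\<pi>\<close> moves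
  \<open>{1..d}\<close> up and \<open>{d<..n}\<close> down, the interval contains \<open>d\<close> and \<open>d + 1\<close>, hence also their images
  \<open>n\<close> and \<open>1\<close>.\<close>

lemma commuting_descent_perm:
  assumes \<rho>: "\<rho> permutes {1..n}" "only_descent n \<rho> e" and comm: "\<And>i. \<pi> (\<rho> i) = \<rho> (\<pi> i)"
  shows "descent_perm n e \<rho>"
proof -
  define M where "M = {i. \<rho> i \<noteq> i}"
  have sub: "M \<subseteq> {1..n}" using permutes_not_in[OF \<rho>(1)] unfolding M_def by blast
  then have fin: "finite M" by (rule finite_subset) simp
  have inv: "\<pi> i \<in> M \<longleftrightarrow> i \<in> M" for i
    using comm[of i] inj_eq[OF permutes_inj[OF perm], of "\<rho> i" i] by (simp add: M_def)
  have ne: "M \<noteq> {}" using only_descent_imp_ne_id[OF \<rho>(2)] unfolding M_def by auto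
  have e: "1 \<le> e" "e < n" using only_descentD[OF \<rho>(2)] by auto
  have range: "1 \<le> \<rho> i \<and> \<rho> i \<le> n" if "1 \<le> i" "i \<le> n" for i
    using permutes_in_image[OF \<rho>(1), of i] that by (metis atLeastAtMost_iff)
  \<comment> \<open>Up to \<open>e\<close> no point moves down, and once a point moves up so do its
    successors; beyond \<open>e\<close> no point moves up, and once a point moves down so do its
    predecessors.\<close>
  have convex: "y \<in> M" if xz: "x \<in> M" "z \<in> M" and y: "x \<le> y" "y \<le> z" for x y z
  proof (cases "y \<le> e")
    case True
    have "x < \<rho> x"
      using only_descent_gap[OF \<rho>, of 1 x] xz sub y True range[of 1] e by (force simp: M_def)
    then have "y < \<rho> y"
      using only_descent_gap[OF \<rho>, of x y] xz sub y True e by force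
    then show ?thesis by (simp add: M_def)
  next
    case False
    have "\<rho> z < z"
      using only_descent_gap[OF \<rho>, of z n] xz sub y False range[of n] e by (force simp: M_def)
    then have "\<rho> y < y"
      using only_descent_gap[OF \<rho>, of y z] xz sub y False e by force
    then show ?thesis by (simp add: M_def)
  qed
  have "\<not> Max M \<le> d"
    using up[of "Max M"] Max_in[OF fin ne] sub inv[of "Max M"] Max_ge[OF fin, of "\<pi> (Max M)"] by force
  moreover have "\<not> d < Min M"
    using down[of "Min M"] Min_in[OF fin ne] sub inv[of "Min M"] Min_le[OF fin, of "\<pi> (Min M)"] by force
  ultimately have "d \<in> M" "Suc d \<in> M"
    using convex[OF Min_in[OF fin ne] Max_in[OF fin ne]] by auto
  then have "n \<in> M" "1 \<in> M" using inv[of d] inv[of "Suc d"] top bottom by auto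
  then show ?thesis using \<rho> by unfold_locales (auto simp: M_def)
qed

lemma commuting_descents_eq:
  assumes \<rho>: "descent_perm n e \<rho>" and comm: "\<And>i. \<pi> (\<rho> i) = \<rho> (\<pi> i)" and "\<pi> 1 < \<pi> n"
  shows "e = d"
proof (rule ccontr)
  assume "e \<noteq> d"
  interpret \<rho>: descent_perm n e \<rho> by fact
  have "\<rho> (\<pi> (Suc e)) < \<rho> (\<pi> e)"
    using assms(3) comm[of e] comm[of "Suc e"] \<rho>.top \<rho>.bottom by simp
  moreover have less: "\<pi> e < \<pi> (Suc e)"
    using only_descent_step[OF perm desc, of e] \<rho>.d_bounds \<open>e \<noteq> d\<close> by auto
  \<comment> \<open>Since \<open>\<rho>\<close> is increasing on each side of \<open>e\<close>, it
    can reverse the order of \<open>\<pi> e\<close> and \<open>\<pi> (Suc e)\<close> only if they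
    straddle \<open>e\<close>.\<close>
  ultimately have "\<pi> e \<le> e" "e < \<pi> (Suc e)"
    using only_descent_less_iff[OF \<rho>.perm \<rho>.desc, of "\<pi> e" "\<pi> (Suc e)"] \<rho>.d_bounds
      bounds[of e] bounds[of "Suc e"] by fastforce+
  then show False
    using up[of e] down[of "Suc e"] \<rho>.d_bounds \<open>e \<noteq> d\<close> by (cases "e < d") auto
qed

text \<open>The count depends on \<open>d\<close> alone, so it agrees for any two permutations
  sharing the descent \<open>d\<close>.\<close>

lemma card_preimage_atMost: "card {j \<in> {1..n}. \<pi> j \<le> d} = d"
proof -
  have "\<pi> ` {j \<in> {1..n}. \<pi> j \<le> d} = {1..d}"
  proof (intro equalityI subsetI)
    fix y assume y: "y \<in> {1..d}"
    obtain j where j: "\<pi> j = y" using permutes_surj[OF perm] by (metis surjD)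
    with y in_range[of j] d_bounds have "j \<in> {1..n}" by auto
    with j y show "y \<in> \<pi> ` {j \<in> {1..n}. \<pi> j \<le> d}" by auto
  qed (use bounds in auto)
  then show ?thesis
    using card_image[OF permutes_inj_on[OF perm], of "{j \<in> {1..n}. \<pi> j \<le> d}"] by simp
qed

text \<open>A descent \<open>i \<noteq> d\<close> of the product occurs where both \<open>\<pi>\<close> and \<open>\<rho>\<close> cross from values \<open>\<le> d\<close> to
  values \<open>> d\<close> within the run containing \<open>i\<close>; the crossing point of the other run is then forced by
  \<open>card_preimage_atMost\<close>.\<close>

lemma commuting_product:
  assumes \<rho>: "descent_perm n d \<rho>" and comm: "\<And>i. \<pi> (\<rho> i) = \<rho> (\<pi> i)" and wrap: "\<pi> 1 < \<pi> n"
  shows "(\<forall>i\<in>{1..n}. \<pi> i \<le> d \<longleftrightarrow> \<rho> i \<le> d) \<or> only_descent n (\<pi> \<circ> \<rho>) d"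
proof -
  interpret \<rho>: descent_perm n d \<rho> by fact
  define P where "P = {j \<in> {1..n}. \<pi> j \<le> d}"
  define Q where "Q = {j \<in> {1..n}. \<rho> j \<le> d}"
  have card: "card P = card Q"
    unfolding P_def Q_def using card_preimage_atMost \<rho>.card_preimage_atMost by simp
  have d: "\<pi> (\<rho> (Suc d)) < \<pi> (\<rho> d)"
    using wrap \<rho>.top \<rho>.bottom by simp
  show ?thesis
  proof (cases "\<exists>i. 1 \<le> i \<and> i < n \<and> i \<noteq> d \<and> \<pi> (\<rho> (Suc i)) < \<pi> (\<rho> i)")
    case True
    then obtain i where i: "1 \<le> i" "i < n" "i \<noteq> d" "\<pi> (\<rho> (Suc i)) < \<pi> (\<rho> i)" by blast
    \<comment> \<open>By \<open>comm\<close> the descent at \<open>i\<close> is also one of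
      \<open>\<rho> \<circ> \<pi>\<close>, while \<open>\<pi> i < \<pi> (Suc i)\<close>; so these
      two values lie on different sides of \<open>d\<close>. Exchanging the roles of
      \<open>\<pi>\<close> and \<open>\<rho>\<close> gives \<open>\<rho>i\<close>.\<close>
    have \<pi>i: "\<pi> i \<le> d" "d < \<pi> (Suc i)"
      using only_descent_less_iff[OF \<rho>.perm \<rho>.desc, of "\<pi> i" "\<pi> (Suc i)"] i comm
        only_descent_step[OF perm desc i(1-3)] bounds[of i] bounds[of "Suc i"] by fastforce+
    have \<rho>i: "\<rho> i \<le> d" "d < \<rho> (Suc i)"
      using only_descent_less_iff[OF perm desc, of "\<rho> i" "\<rho> (Suc i)"] i
        only_descent_step[OF \<rho>.perm \<rho>.desc i(1-3)] \<rho>.bounds[of i] \<rho>.bounds[of "Suc i"] by fastforce+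
    have iff: "(f j \<le> d) \<longleftrightarrow> j \<le> i"
      if "descent_perm n d f" "f i \<le> d" "d < f (Suc i)" "j \<in> {1..n}" "j \<le> d \<longleftrightarrow> i \<le> d" for f j
    proof -
      interpret f: descent_perm n d f by fact
      show ?thesis
        using only_descent_less_iff[OF f.perm f.desc, of i j]
          only_descent_less_iff[OF f.perm f.desc, of j "Suc i"] that i
        by (cases "j \<le> i"; cases "j = Suc i") (auto simp: Suc_le_eq)
    qed
    have same: "j \<in> P \<longleftrightarrow> j \<in> Q" if "j \<le> d \<longleftrightarrow> i \<le> d" for j
      using iff[OF descent_perm_axioms \<pi>i, of j] iff[OF \<rho> \<rho>i, of j] that by (auto simp: P_def Q_def)
    have closed: "a \<in> {j \<in> {1..n}. f j \<le> d}"
      if "descent_perm n d f" "b \<in> {j \<in> {1..n}. f j \<le> d}" "a \<in> {1..n}" "a \<le> b" "a \<le> d \<longleftrightarrow> b \<le> d" for f a b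
    proof -
      interpret f: descent_perm n d f by fact
      show ?thesis
        using only_descent_less_iff[OF f.perm f.desc, of a b] that by (cases "a = b") auto
    qed
    \<comment> \<open>By \<open>same\<close>, \<open>P\<close> and \<open>Q\<close> can differ only
      in the run not containing \<open>i\<close>, and there both are initial segments, hence
      nested.\<close>
    have "P \<subseteq> Q \<or> Q \<subseteq> P"
    proof (rule ccontr)
      assume "\<not> ?thesis"
      then obtain a b where ab: "a \<in> P" "a \<notin> Q" "b \<in> Q" "b \<notin> P" by blast
      then have "a \<le> d \<longleftrightarrow> b \<le> d" using same[of a] same[of b] by blast
      moreover have "a \<in> {1..n}" "b \<in> {1..n}" using ab by (auto simp: P_def Q_def)
      ultimately show False
        using closed[OF \<rho>, folded Q_def, of b a] closed[OF descent_perm_axioms, folded P_def, of a b]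
          ab linear[of a b] by blast
    qed
    then have "P = Q"
      using card card_subset_eq[of Q P] card_subset_eq[of P Q] by (auto simp: P_def Q_def)
    then have "\<pi> i \<le> d \<longleftrightarrow> \<rho> i \<le> d" if "i \<in> {1..n}" for i
      using that unfolding P_def Q_def by blast
    then show ?thesis by blast
  next
    case False
    then have "only_descent n (\<pi> \<circ> \<rho>) d"
      unfolding only_descent_def using d d_bounds by fastforce
    then show ?thesis ..
  qed
qed

section \<open>Itineraries, rotations and powers\<close>

lemma funpow_range: "(\<pi> ^^ m) i \<in> {1..n} \<longleftrightarrow> i \<in> {1..n}"
  by (rule permutes_in_image[OF permutes_funpow[OF perm]])

lemma funpow_less:
  assumes "i \<in> {1..n}" "j \<in> {1..n}" "\<And>m. (\<pi> ^^ m) i \<le> d \<longleftrightarrow> (\<pi> ^^ m) j \<le> d" "i < j"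
  shows "(\<pi> ^^ m) i < (\<pi> ^^ m) j"
proof (induction m)
  case (Suc m)
  then show ?case
    using only_descent_less_iff[OF perm desc, of "(\<pi> ^^ m) i" "(\<pi> ^^ m) j"] assms funpow_range
    by (simp del: atLeastAtMost_iff)
qed (use assms in simp)

lemma funpow_eq_id:
  assumes same: "\<And>i. i \<in> {1..n} \<Longrightarrow> \<pi> i \<le> d \<longleftrightarrow> (\<pi> ^^ Suc m) i \<le> d"
  shows "\<pi> ^^ m = id"
proof
  fix i
  define \<tau> where "\<tau> = \<pi> ^^ m"
  have \<tau>_range: "\<tau> j \<in> {1..n} \<longleftrightarrow> j \<in> {1..n}" for j
    unfolding \<tau>_def by (rule funpow_range)
  have \<tau>_pow: "\<tau> ^^ t = \<pi> ^^ (m * t)" for t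
    unfolding \<tau>_def by (simp add: funpow_mult)
  have comm: "(\<pi> ^^ t) (\<tau> j) = \<tau> ((\<pi> ^^ t) j)" for t j
    unfolding \<tau>_def by (metis add.commute comp_apply funpow_add)
  have side: "\<tau> j \<le> d \<longleftrightarrow> j \<le> d" if "j \<in> {1..n}" for j
  proof -
    obtain l where l: "\<pi> l = j" using permutes_surj[OF perm] by (metis surjD)
    with that have "l \<in> {1..n}" using in_range by metis
    from same[OF this] l show ?thesis
      unfolding \<tau>_def by (simp add: funpow_swap1)
  qed
  have side': "(\<pi> ^^ t) (\<tau> j) \<le> d \<longleftrightarrow> (\<pi> ^^ t) j \<le> d" if "j \<in> {1..n}" for t j
    using side[of "(\<pi> ^^ t) j"] that comm funpow_range by simp
  show "(\<pi> ^^ m) i = id i"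
  proof (cases "i \<in> {1..n}")
    case False
    then show ?thesis using permutes_not_in[OF permutes_funpow[OF perm]] by simp
  next
    case True
    have orbit: "(\<tau> ^^ t) i \<in> {1..n}" for t
      using True funpow_range \<tau>_pow by simp
    \<comment> \<open>With equal itineraries, \<open>\<pi> ^^ (m * t)\<close> preserves the order of
      \<open>i\<close> and \<open>\<tau> i\<close>, so one move up would repeat forever inside
      \<open>{1..n}\<close>.\<close>
    have not_less: "\<not> i < \<tau> i"
    proof
      assume "i < \<tau> i"
      then have "(\<tau> ^^ t) i < (\<tau> ^^ Suc t) i" for t
        using funpow_less[OF True _ side'[OF True, symmetric], of "m * t"] True \<tau>_range[of i]
        unfolding \<tau>_pow[symmetric] by (simp add: funpow_swap1 del: atLeastAtMost_iff)
      then show False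
        using gap_le_of_step_less[of 0 "Suc n" "\<lambda>t. (\<tau> ^^ t) i"] orbit[of "Suc n"] by simp
    qed
    have not_greater: "\<not> \<tau> i < i"
    proof
      assume "\<tau> i < i"
      then have dec: "(\<tau> ^^ Suc t) i < (\<tau> ^^ t) i" for t
        using funpow_less[OF _ True side'[OF True], of "m * t"] True \<tau>_range[of i]
        unfolding \<tau>_pow[symmetric] by (simp add: funpow_swap1 del: atLeastAtMost_iff)
      have "(\<tau> ^^ t) i + t \<le> i" for t
      proof (induction t)
      case (Suc t)
      then show ?case using dec[of t] by linarith
    qed simp
      from this[of "Suc i"] show False by simp
    qed
    from not_less not_greater show ?thesis by (simp add: \<tau>_def)
  qed
qed

lemma rotation:
  assumes "\<pi> n < \<pi> 1"
  shows "\<exists>s\<in>{1..n}. \<forall>i\<in>{1..n}. [\<pi> i = i + s] (mod n)"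
proof -
  \<comment> \<open>Adding \<open>n\<close> after the descent turns the drop from \<open>n\<close>
    to 1 into a step of 1. Then \<open>F\<close> is strictly increasing with total growth at most
    \<open>n - 1\<close>, so every step is exactly 1.\<close>
  define F where "F i = (if i \<le> d then \<pi> i else \<pi> i + n)" for i
  have step: "F l < F (Suc l)" if "1 \<le> l" "l < n" for l
    using only_descent_step[OF perm desc that] bounds[of l] bounds[of "Suc l"] that top bottom
    by (auto simp: F_def)
  have F: "F i = \<pi> 1 - 1 + i" if i: "i \<in> {1..n}" for i
  proof -
    have "F 1 + (i - 1) \<le> F i" "F i + (n - i) \<le> F n"
      by (rule gap_le_of_step_less; use step i in force)+
    moreover have "F 1 = \<pi> 1" "F n = \<pi> n + n" using d_bounds by (auto simp: F_def)
    ultimately show ?thesis using assms i bounds[of 1] by auto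
  qed
  have "[\<pi> i = i + (\<pi> 1 - 1)] (mod n)" if "i \<in> {1..n}" for i
    using F[OF that] by (auto simp: F_def cong_def add.commute split: if_splits)
      (metis mod_add_self1)+
  moreover have "\<pi> 1 - 1 \<in> {1..n}" using first bounds[of 1] d_bounds by auto
  ultimately show ?thesis by blast
qed

text \<open>The two conditions sustain each other: \<open>\<pi> ^^ (m + t) \<noteq> id\<close>
  excludes, by \<open>funpow_eq_id\<close>, the first case of \<open>commuting_product\<close>, and
  the descent of \<open>\<pi> ^^ Suc (m + t)\<close> provides the next non-identity.\<close>

lemma powers_only_descent:
  assumes wrap: "\<pi> 1 < \<pi> n" and "only_descent n (\<pi> ^^ Suc m) e" "\<pi> ^^ m \<noteq> id"
  shows "(\<exists>e. only_descent n (\<pi> ^^ Suc (m + t)) e) \<and> \<pi> ^^ (m + t) \<noteq> id"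
proof (induction t)
  case 0
  then show ?case using assms(2,3) by (auto simp del: funpow.simps)
next
  case (Suc t)
  then obtain e' where e': "only_descent n (\<pi> ^^ Suc (m + t)) e'" and ne: "\<pi> ^^ (m + t) \<noteq> id"
    by blast
  have comm: "\<pi> ((\<pi> ^^ Suc (m + t)) i) = (\<pi> ^^ Suc (m + t)) (\<pi> i)" for i
    by (simp add: funpow_swap1)
  have \<rho>: "descent_perm n e' (\<pi> ^^ Suc (m + t))"
    using commuting_descent_perm[OF permutes_funpow[OF perm] e' comm] .
  with commuting_descents_eq[OF \<rho> comm wrap] have "descent_perm n d (\<pi> ^^ Suc (m + t))" by simp
  from commuting_product[OF this comm wrap] funpow_eq_id[of "m + t"] ne
  have "only_descent n (\<pi> \<circ> \<pi> ^^ Suc (m + t)) d" by blast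
  then show ?case using only_descent_imp_ne_id[OF e'] by (metis add_Suc_right funpow.simps(2))
qed

end

theorem theorem1p3:
  fixes n k :: nat and \<pi> :: "nat \<Rightarrow> nat"
  assumes "k \<ge> 3" and "n \<ge> 1"
    and "grassmannian n \<pi>"
    and "\<pi> 1 \<noteq> 1" and "\<pi> n \<noteq> n"
    and "des n (\<pi> ^^ k) = 1"
  shows "(\<exists>s\<in>{1..n}. \<forall>i\<in>{1..n}. [\<pi> i = i + s] (mod n)) \<or> \<pi> ^^ (k - 1) = id"
proof -
  have perm: "\<pi> permutes {1..n}" and des: "des n \<pi> \<le> 1"
    using assms(3) by (auto simp: grassmannian_def)
  have image: "\<pi> i \<in> {1..n}" if "i \<in> {1..n}" for i
    using permutes_in_image[OF perm] that by blast
  have "des n \<pi> \<noteq> 0"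
  proof
    assume "des n \<pi> = 0"
    then have no_descent: "{i \<in> {1..<n}. \<pi> i > \<pi> (i + 1)} = {}"
      by (simp add: des_def del: atLeastLessThan_iff)
    have step: "\<pi> l < \<pi> (Suc l)" if "1 \<le> l" "l < n" for l
    proof -
      have "\<pi> l \<noteq> \<pi> (Suc l)" using inj_eq[OF permutes_inj[OF perm], of l "Suc l"] by simp
      moreover have "\<not> \<pi> (Suc l) < \<pi> l" using no_descent that by auto
      ultimately show ?thesis by simp
    qed
    have "\<pi> 1 + (n - 1) \<le> \<pi> n"
      by (rule gap_le_of_step_less) (use step assms(2) in auto)
    with image[of 1] image[of n] assms(2,4) show False by auto
  qed
  with des obtain d where d: "only_descent n \<pi> d"
    using des_eq_1_iff[of n \<pi>] by (auto simp: le_Suc_eq)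
  interpret descent_perm n d \<pi>
    using perm d assms(4,5) by unfold_locales
  show ?thesis
  proof (cases "\<pi> 1 < \<pi> n")
    case False
    have "\<pi> 1 \<noteq> \<pi> n"
      using inj_eq[OF permutes_inj[OF perm], of 1 n] d_bounds by auto
    with False rotation show ?thesis by simp
  next
    case True
    obtain m where m: "k = Suc m" using assms(1) by (cases k) auto
    obtain e where e: "only_descent n (\<pi> ^^ Suc m) e"
      using assms(6) des_eq_1_iff m by auto
    obtain N where N: "\<pi> ^^ N = id" "N > 0"
      using perm permutation_permutes permutation_is_nilpotent by blast
    \<comment> \<open>The exponent \<open>N * m\<close> gives the identity and is at least
      \<open>m\<close>, so the propagation from \<open>m\<close> would reach it.\<close>
    have "\<pi> ^^ (N * m) = id"
      using N(1) by (simp add: funpow_mult[symmetric])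
    moreover have "N * m = m + (N * m - m)" using N(2) by (cases N) auto
    ultimately show ?thesis
      using powers_only_descent[OF True e, of "N * m - m"] m by (metis diff_Suc_1)
  qed
qed

end
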